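(* Let $d \ge 1$, $L>0$ and $0<\epsilon\le 0.01$. There exists a learning-to-rent algorithm with the following guarantee: for every $L$-Lipschitz joint distribution $\mathbb{K}$ of $(x,y)$ with $x\in[0,1]^d$ and $y\in(0,\infty)$, given $n=\left(\frac{L\sqrt d}{\epsilon}\right)^{O(d)}$ i.i.d. samples from $\mathbb{K}$, the algorithm outputs a threshold function $\theta_A:[0,1]^d\to\mathbb{R}^+$ which, with probability at least $1-\epsilon^{\Omega(d)}$ (over the samples), is $(1+\epsilon)$-accurate, i.e. $$\mathbb{E}_{(x,y)\sim\mathbb{K}}[g(\theta_A(x),y)]\le(1+\epsilon)\,\inf_{\theta:[0,1]^d\to\mathbb{R}^+}\mathbb{E}_{(x,y)\sim\mathbb{K}}[g(\theta(x),y)].$$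
   Context: Ski-rental (rent-or-buy) setting: buying costs $1$, renting costs $1$ per unit time, and the season has length $y>0$. A threshold strategy with threshold $\theta\ge 0$ rents until time $\theta$ and then buys. Its competitive ratio on input $y$ is $$g(\theta,y)=\begin{cases}\frac{1+\theta}{\min\{1,y\}} & \text{if } y\ge\theta,\\ \frac{y}{\min\{1,y\}} & \text{otherwise.}\end{cases}$$ For a distribution $\mathbb{K}$ of $y$, write $\mathrm{CR}(\theta,\mathbb{K})=\mathbb{E}_{y\sim\mathbb{K}}[g(\theta,y)]$. Learning-to-rent problem: there is an unknown joint distribution $\mathbb{K}$ of (feature vector, season length) $(x,y)\in\mathbb{R}^d\times(0,\infty)$; the algorithm receives i.i.d. samples from $\mathbb{K}$ and outputs a threshold function $\theta_A$ mapping feature vectors to thresholds; it is $(1+\epsilon)$-accurate if its expected competitive ratio $\mathbb{E}_{(x,y)\sim\mathbb{K}}[g(\theta_A(x),y)]$ is at most $(1+\epsilon)$ times the optimal expected competitive ratio achievable by any threshold function of $x$. Earth mover distance: for probability distributions $\mathbb{X},\mathbb{Y}$ on $\mathbb{R}^k$, $\mathrm{EMD}(\mathbb{X},\mathbb{Y})=\min\mathbb{E}_{(u,v)\sim\mathbb{J}}\|u-v\|$, the minimum over all couplings $\mathbb{J}$ with marginals $\mathbb{X}$ and $\mathbb{Y}$. A joint distribution of $(x,y)\in\mathbb{R}^d\times\mathbb{R}^+$ is $L$-Lipschitz if for all $x_1,x_2$, the conditional distributions $\mathbb{Y}_1=y\mid x_1$ and $\mathbb{Y}_2=y\mid x_2$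 satisfy $\mathrm{EMD}(\mathbb{Y}_1,\mathbb{Y}_2)\le L\|x_1-x_2\|_2$.
   Formalization: The sample bound is proved as n ≤ (max{1,L}·√d/ε)^{O(d)} instead of (L√d/ε)^{O(d)}, since for L√d < ε the latter is below 1 and would force n = 0, where no algorithm can be (1+ε)-accurate; infimum over measurable θ. *)

theory Defs
  imports "HOL-Probability.Probability"
begin

text \<open>Feature vectors in R^d are rendered as extensional functions on {..<d}
  (the canonical finite product space of HOL-Probability).\<close>

definition Xsp :: "nat \<Rightarrow> (nat \<Rightarrow> real) measure" where
  "Xsp d = PiM {..<d} (\<lambda>_. (borel :: real measure))"

definition cube :: "nat \<Rightarrow> (nat \<Rightarrow> real) set" where
  "cube d = PiE {..<d} (\<lambda>_. {0..1::real})"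

definition dist_d :: "nat \<Rightarrow> (nat \<Rightarrow> real) \<Rightarrow> (nat \<Rightarrow> real) \<Rightarrow> real" where
  "dist_d d x x' = sqrt (\<Sum>i<d. (x i - x' i)^2)"

text \<open>Earth mover distance between probability distributions on R (the only case
  needed: conditional distributions of the season length y).\<close>
definition EMD :: "real measure \<Rightarrow> real measure \<Rightarrow> ennreal" where
  "EMD X Y = (INF J \<in> {J :: (real \<times> real) measure. prob_space J
        \<and> sets J = sets (borel \<Otimes>\<^sub>M borel)
        \<and> distr J borel fst = X \<and> distr J borel snd = Y}.
        \<integral>\<^sup>+ z. ennreal \<bar>fst z - snd z\<bar> \<partial>J)"

definition joint_dist :: "nat \<Rightarrow> ((nat \<Rightarrow> real) \<times> real) measure \<Rightarrow> bool" where
  "joint_dist d K \<longleftrightarrow> prob_space K \<and> sets K = sets (Xsp d \<Otimes>\<^sub>M borel)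
      \<and> emeasure K (cube d \<times> {0<..}) = 1"

text \<open>L-Lipschitz: the conditional distributions y | x (given by a regular conditional
  distribution, i.e. a Markov kernel kappa disintegrating K w.r.t. its x-marginal)
  satisfy EMD(y|x1, y|x2) <= L * ||x1 - x2||_2 for all x1, x2.\<close>
definition lipschitz_dist :: "nat \<Rightarrow> real \<Rightarrow> ((nat \<Rightarrow> real) \<times> real) measure \<Rightarrow> bool" where
  "lipschitz_dist d L K \<longleftrightarrow> (\<exists>\<kappa>. \<kappa> \<in> Xsp d \<rightarrow>\<^sub>M prob_algebra borel
      \<and> (\<forall>A \<in> sets (Xsp d). \<forall>B \<in> sets borel.
            emeasure K (A \<times> B) = (\<integral>\<^sup>+ x \<in> A. emeasure (\<kappa> x) B \<partial>(distr K (Xsp d) fst)))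
      \<and> (\<forall>x1 \<in> cube d. \<forall>x2 \<in> cube d. EMD (\<kappa> x1) (\<kappa> x2) \<le> ennreal (L * dist_d d x1 x2)))"

text \<open>Competitive ratio of threshold theta on season length y.\<close>
definition g :: "real \<Rightarrow> real \<Rightarrow> real" where
  "g \<theta> y = (if y \<ge> \<theta> then (1 + \<theta>) / min 1 y else y / min 1 y)"

definition ecr :: "((nat \<Rightarrow> real) \<times> real) measure \<Rightarrow> ((nat \<Rightarrow> real) \<Rightarrow> real) \<Rightarrow> ennreal" where
  "ecr K \<theta> = (\<integral>\<^sup>+ z. ennreal (g (\<theta> (fst z)) (snd z)) \<partial>K)"

text \<open>Threshold functions [0,1]^d -> R^+ (measurable, so that the expectation is defined).\<close>
definition threshold_fns :: "nat \<Rightarrow> ((nat \<Rightarrow> real) \<Rightarrow> real) set" where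
  "threshold_fns d = {\<theta>. \<theta> \<in> borel_measurable (Xsp d) \<and> (\<forall>x \<in> cube d. 0 \<le> \<theta> x)}"

definition opt_ecr :: "nat \<Rightarrow> ((nat \<Rightarrow> real) \<times> real) measure \<Rightarrow> ennreal" where
  "opt_ecr d K = (INF \<theta> \<in> threshold_fns d. ecr K \<theta>)"

definition accurate :: "nat \<Rightarrow> real \<Rightarrow> ((nat \<Rightarrow> real) \<times> real) measure \<Rightarrow> ((nat \<Rightarrow> real) \<Rightarrow> real) \<Rightarrow> bool" where
  "accurate d \<epsilon> K \<theta> \<longleftrightarrow> \<theta> \<in> threshold_fns d \<and> ecr K \<theta> \<le> ennreal (1 + \<epsilon>) * opt_ecr d K"

end

theory Submission
  imports Defs
begin

text \<open>The algorithm is empirical risk minimisation over the finite class of threshold functions that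
  are constant on the cells of a fine grid on the cube and take values in a finite grid of
  thresholds. Hoeffding's inequality and a union bound make all empirical ratios close to the true
  ones, since thresholds in \<open>[\<eta>, 1 / \<eta>]\<close> have ratios at most \<open>2 / \<eta>\<close>.

  The class contains a nearly optimal function although the ratio is discontinuous in the season
  length: if \<open>\<mu>\<close> and \<open>\<nu>\<close> are close in earth mover distance, then a threshold slightly above \<open>t\<close> does on \<open>\<nu>\<close>
  almost as well as \<open>t\<close> does on \<open>\<mu>\<close>, because a slightly larger threshold never buys
  where \<open>t\<close> would have kept renting on a nearby season. Applying this from a point of a cell to a
  reference point and back shows that one threshold serves the whole cell.\<close>

section \<open>Empirical risk minimisation\<close>

text \<open>Independence means that the joint law is the product of the marginal laws. The joint law
  of the coordinates is the product measure itself, as restricting to \<open>I\<close> is the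
  identity on its space, and every marginal is \<open>K\<close>.\<close>

lemma indep_vars_PiM_coordinates:
  assumes K: "prob_space K" and I: "finite I" "I \<noteq> {}"
  shows "prob_space.indep_vars (PiM I (\<lambda>_. K)) (\<lambda>_. K) (\<lambda>i \<omega>. \<omega> i) I"
proof -
  interpret K: prob_space K by fact
  interpret P: product_prob_space "\<lambda>_. K" I ..
  have "distr (PiM I (\<lambda>_. K)) (PiM I (\<lambda>_. K)) (\<lambda>x. \<lambda>i\<in>I. x i) = distr (PiM I (\<lambda>_. K)) (PiM I (\<lambda>_. K)) (\<lambda>x. x)"
    by (rule distr_cong) (auto simp: space_PiM)
  also have "\<dots> = PiM I (\<lambda>i. distr (PiM I (\<lambda>_. K)) K (\<lambda>\<omega>. \<omega> i))"
    by (simp add: distr_id2 P.PiM_component cong: PiM_cong)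
  finally show ?thesis
    using I by (subst P.P.indep_vars_iff_distr_eq_PiM') auto
qed

text \<open>An i.i.d. sample is modelled by the coordinates of a product measure; this puts
  Hoeffding's inequality into that form, with the expectation taken under \<open>K\<close>.\<close>

lemma Hoeffding_iid_sample_mean:
  fixes f :: "'a \<Rightarrow> real"
  assumes K: "prob_space K" and f[measurable]: "f \<in> borel_measurable K"
    and bounds: "\<And>z. f z \<in> {0..B}" and "0 < B" "0 < n" "0 \<le> \<tau>"
  shows "measure (PiM {..<n} (\<lambda>_. K)) {s \<in> space (PiM {..<n} (\<lambda>_. K)).
      \<bar>(\<Sum>i<n. f (s i)) / real n - (\<integral>z. f z \<partial>K)\<bar> \<ge> \<tau>} \<le> 2 * exp (- 2 * real n * \<tau>\<^sup>2 / B\<^sup>2)"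
proof -
  interpret K: prob_space K by fact
  interpret P: product_prob_space "\<lambda>_. K" "{..<n}" ..
  let ?P = "PiM {..<n} (\<lambda>_. K)"
  have distr: "distr ?P borel (\<lambda>s. f (s i)) = distr K borel f" if "i < n" for i
  proof -
    have "distr ?P borel (\<lambda>s. f (s i)) = distr (distr ?P K (\<lambda>s. s i)) borel f"
      using that by (subst distr_distr) (auto simp: o_def)
    then show ?thesis using that by (simp add: P.PiM_component)
  qed
  have mean: "(\<integral>s. f (s 0) \<partial>?P) = (\<integral>z. f z \<partial>K)"
  proof -
    have "(\<integral>s. f (s 0) \<partial>?P) = (\<integral>z. f z \<partial>(distr ?P K (\<lambda>s. s 0)))"
      using \<open>0 < n\<close> by (subst integral_distr) auto
    then show ?thesis using \<open>0 < n\<close> by (simp add: P.PiM_component)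
  qed
  interpret Hoeffding_ineq_iid ?P "{..<n}" "\<lambda>i s. f (s i)" "\<lambda>s. f (s 0)" 0 B "\<integral>z. f z \<partial>K"
  proof unfold_locales
    show "P.P.indep_vars (\<lambda>_. borel) (\<lambda>i s. f (s i)) {..<n}"
      using \<open>0 < n\<close>
      by (intro P.P.indep_vars_compose2[OF indep_vars_PiM_coordinates[OF K finite_lessThan]]) auto
    show "AE s in ?P. f (s 0) \<in> {0..B}" using bounds by simp
    show "(\<lambda>s. f (s 0)) \<in> borel_measurable ?P"
      using \<open>0 < n\<close> by (intro measurable_compose[OF _ f] measurable_component_singleton) auto
  qed (use distr \<open>0 < n\<close> in \<open>auto simp: mean\<close>)
  show ?thesis
    using Hoeffding_ineq_abs_ge'[OF \<open>0 \<le> \<tau>\<close> \<open>0 < B\<close>] \<open>0 < n\<close> by (simp add: lessThan_empty_iff)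
qed

definition erm :: "('h \<Rightarrow> 'z \<Rightarrow> real) \<Rightarrow> 'h set \<Rightarrow> nat \<Rightarrow> (nat \<Rightarrow> 'z) \<Rightarrow> 'h" where
  "erm loss H n s = arg_min_on (\<lambda>h. \<Sum>i<n. loss h (s i)) H"

text \<open>\<open>S\<close> is the event that all empirical means are within \<open>\<tau>\<close>
  of the true ones. On it \<open>\<tau>\<close> is lost twice: passing from the true to the
  empirical loss of the minimiser, and back for the competitor \<open>h\<close>.\<close>

lemma erm_generalizes:
  fixes loss :: "'h \<Rightarrow> 'z \<Rightarrow> real"
  assumes K: "prob_space K" and H: "finite H" "H \<noteq> {}"
    and loss[measurable]: "\<And>h. h \<in> H \<Longrightarrow> loss h \<in> borel_measurable K"
    and bounds: "\<And>h z. h \<in> H \<Longrightarrow> loss h z \<in> {0..B}" and "0 < B" "0 < n" "0 \<le> \<tau>"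
  shows "\<exists>S \<in> sets (PiM {..<n} (\<lambda>_. K)).
      measure (PiM {..<n} (\<lambda>_. K)) S \<ge> 1 - 2 * real (card H) * exp (- 2 * real n * \<tau>\<^sup>2 / B\<^sup>2) \<and>
      (\<forall>s\<in>S. erm loss H n s \<in> H \<and>
        (\<forall>h\<in>H. (\<integral>z. loss (erm loss H n s) z \<partial>K) \<le> (\<integral>z. loss h z \<partial>K) + 2 * \<tau>))"
proof -
  interpret K: prob_space K by fact
  interpret P: product_prob_space "\<lambda>_. K" "{..<n}" ..
  let ?P = "PiM {..<n} (\<lambda>_. K)"
  define bad where "bad h = {s \<in> space ?P.
      \<bar>(\<Sum>i<n. loss h (s i)) / real n - (\<integral>z. loss h z \<partial>K)\<bar> \<ge> \<tau>}" for h
  define S where "S = space ?P - (\<Union>h\<in>H. bad h)"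
  have bad[measurable]: "bad h \<in> sets ?P" if "h \<in> H" for h
    using that unfolding bad_def by measurable
  have bads: "(\<Union>h\<in>H. bad h) \<in> sets ?P"
    using H bad by auto
  have "measure ?P (\<Union>h\<in>H. bad h) \<le> (\<Sum>h\<in>H. measure ?P (bad h))"
    by (rule P.P.finite_measure_subadditive_finite) (use H bad in auto)
  also have "\<dots> \<le> (\<Sum>h\<in>H. 2 * exp (- 2 * real n * \<tau>\<^sup>2 / B\<^sup>2))"
    unfolding bad_def
    by (intro sum_mono Hoeffding_iid_sample_mean K loss bounds \<open>0 < B\<close> \<open>0 < n\<close> \<open>0 \<le> \<tau>\<close>)
  finally have "measure ?P S \<ge> 1 - 2 * real (card H) * exp (- 2 * real n * \<tau>\<^sup>2 / B\<^sup>2)"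
    unfolding S_def using bads by (simp add: P.P.prob_compl)
  moreover have "S \<in> sets ?P" unfolding S_def using bads by auto
  moreover have "erm loss H n s \<in> H \<and>
        (\<forall>h\<in>H. (\<integral>z. loss (erm loss H n s) z \<partial>K) \<le> (\<integral>z. loss h z \<partial>K) + 2 * \<tau>)" if "s \<in> S" for s
  proof -
    have close: "\<bar>(\<Sum>i<n. loss h (s i)) / real n - (\<integral>z. loss h z \<partial>K)\<bar> < \<tau>" if "h \<in> H" for h
      using \<open>s \<in> S\<close> that by (auto simp: S_def bad_def not_le)
    have E: "erm loss H n s \<in> H" unfolding erm_def by (rule arg_min_if_finite(1)[OF H])
    moreover have "(\<integral>z. loss (erm loss H n s) z \<partial>K) \<le> (\<integral>z. loss h z \<partial>K) + 2 * \<tau>" if "h \<in> H" for h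
    proof -
      have "(\<Sum>i<n. loss (erm loss H n s) (s i)) / real n \<le> (\<Sum>i<n. loss h (s i)) / real n"
        unfolding erm_def by (intro divide_right_mono arg_min_least H that) auto
      then show ?thesis using close[OF E] close[OF that] by linarith
    qed
    ultimately show ?thesis by blast
  qed
  ultimately show ?thesis by blast
qed

section \<open>The competitive ratio\<close>

text \<open>Buying happens only at \<open>y \<ge> t \<ge> \<eta>\<close>, so the denominator is not
  small; renting throughout means \<open>y < t \<le> 1 / \<eta>\<close>.\<close>

lemma g_bounds:
  assumes "0 < \<eta>" "\<eta> \<le> 1" "\<eta> \<le> t" "t \<le> 1 / \<eta>"
  shows "g t y \<in> {0..2 / \<eta>}"
proof -
  have e: "1 \<le> 1 / \<eta>" "2 / \<eta> = 1 / \<eta> + 1 / \<eta>" using assms by auto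
  have "1 + t \<le> 2 / \<eta> * min 1 t"
  proof (cases "t \<le> 1")
    case True
    have "2 / \<eta> * t \<ge> 2 / \<eta> * \<eta>" using assms by (intro mult_left_mono) auto
    then show ?thesis using True assms by simp
  next
    case False
    then show ?thesis using e assms by simp
  qed
  moreover have "2 / \<eta> * min 1 t \<le> 2 / \<eta> * min 1 y" if "t \<le> y"
    using that assms by (intro mult_left_mono) auto
  ultimately have "(1 + t) / min 1 y \<le> 2 / \<eta>" if "t \<le> y"
    using that assms by (subst pos_divide_le_eq) auto
  moreover have "y / min 1 y \<le> 2 / \<eta> \<and> 0 \<le> y / min 1 y" if "y < t"
  proof (cases "y < 1")
    case True
    \<comment> \<open>Here \<open>y\<close> may also be negative or zero; the value 0 comes from
      \<open>0 / 0 = 0\<close>. The bound thus holds for every real \<open>y\<close>, as the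
      pointwise hypothesis of the Hoeffding lemma requires.\<close>
    then have "y / min 1 y \<in> {0, 1}" by simp
    moreover have "1 \<le> 2 / \<eta>" using e by linarith
    ultimately show ?thesis using assms by auto
  next
    case False
    then have "y / min 1 y = y" by simp
    moreover have "y \<le> 2 / \<eta>" "0 \<le> y" using False that assms e by linarith+
    ultimately show ?thesis by simp
  qed
  ultimately show ?thesis using assms by (auto simp: g_def)
qed

lemma g_ge_1:
  assumes "0 \<le> t" "0 < y"
  shows "1 \<le> g t y"
  using assms by (auto simp: g_def min_def field_simps)

lemma g_borel_measurable[measurable]:
  assumes [measurable]: "f \<in> borel_measurable M" "h \<in> borel_measurable M"
  shows "(\<lambda>x. g (f x) (h x)) \<in> borel_measurable M"
  unfolding g_def by measurable

text \<open>A threshold moved up by at least \<open>\<eta>\<close> is insensitive to perturbations of the season length by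
  at most \<open>\<eta>\<^sup>2\<close>: if the new strategy buys on \<open>y'\<close>, then the old one buys on \<open>y\<close>. At the cap \<open>1 / \<eta>\<close>
  it need not, but then it already pays almost as much in rent.\<close>

lemma g_perturb_near:
  assumes \<eta>: "0 < \<eta>" "\<eta> \<le> 1/4" and t: "0 \<le> t" "\<eta> \<le> t'" "t' \<le> t + 2 * \<eta>"
    and alt: "t + \<eta> \<le> t' \<or> t' = 1 / \<eta>" and y: "0 < y" "0 < y'"
    and near: "\<bar>y - y'\<bar> \<le> \<eta>\<^sup>2"
  shows "g t' y' \<le> (1 + 4 * \<eta>) * g t y"
proof -
  have sq: "\<eta>\<^sup>2 \<le> \<eta> / 4" using \<eta> by (simp add: power2_eq_square)
  have g1: "1 \<le> g t y" using g_ge_1[of t y] t y by simp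
  have "0 \<le> \<eta> * t" using \<eta> t by simp
  moreover have "(1 + 2 * \<eta>) * (1 + t) = 1 + t + 2 * \<eta> + 2 * (\<eta> * t)" by (simp add: algebra_simps)
  ultimately have grow: "1 + t' \<le> (1 + 2 * \<eta>) * (1 + t)" using t by linarith
  have max_eq: "x / min 1 x = max 1 x" if "0 < x" for x :: real
    using that by (auto simp: min_def max_def)
  have buy: "1 + t \<le> (1 + t) / min 1 y" 
    using y t by (subst pos_le_divide_eq) (auto intro: mult_left_le)
  show ?thesis
  proof (cases "t' \<le> y'")
    case rent: False
    then have g': "g t' y' = max 1 y'" using y by (simp add: g_def max_eq)
    show ?thesis
    proof (cases "t \<le> y")
      case True
      have "(1 + 2 * \<eta>) * (1 + t) \<le> (1 + 4 * \<eta>) * g t y"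
        using buy True \<eta> t y by (intro mult_mono) (auto simp: g_def)
      moreover have "max 1 y' \<le> (1 + 2 * \<eta>) * (1 + t)"
        using rent grow t \<eta> by (auto simp: max_def)
      ultimately show ?thesis using g' by linarith
    next
      case False
      then have "g t y = max 1 y" using y by (simp add: g_def max_eq)
      moreover have "max 1 y' \<le> max 1 y + \<eta>" using near sq \<eta> by auto
      moreover have "4 * \<eta> * g t y \<ge> 4 * \<eta> * 1" using g1 \<eta> by (intro mult_left_mono) auto
      moreover have "(1 + 4 * \<eta>) * g t y = g t y + 4 * \<eta> * g t y" by (simp add: algebra_simps)
      ultimately show ?thesis using g' \<eta> by linarith
    qed
  next
    case buy': True
    then have g': "g t' y' = (1 + t') / min 1 y'" by (simp add: g_def)
    show ?thesis
    proof (cases "t \<le> y")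
      case True
      \<comment> \<open>As the new strategy buys only after time \<open>\<eta>\<close>, an additive
        change of \<open>\<eta>\<^sup>2\<close> in the denominator is a relative change of at most
        \<open>\<eta>\<close>.\<close>
      have m: "\<eta> \<le> min 1 y'" using buy' t \<eta> by auto
      have "min 1 y \<le> min 1 y' + \<eta>\<^sup>2" using near by auto
      also have "\<eta>\<^sup>2 \<le> \<eta> * min 1 y'" using m \<eta> by (simp add: power2_eq_square)
      finally have "min 1 y \<le> (1 + \<eta>) * min 1 y'" by (simp add: algebra_simps)
      then have "(1 + t') * min 1 y \<le> ((1 + 2 * \<eta>) * (1 + t)) * ((1 + \<eta>) * min 1 y')"
        using grow t \<eta> y by (intro mult_mono) auto
      also have "\<dots> = ((1 + 2 * \<eta>) * (1 + \<eta>)) * ((1 + t) * min 1 y')" by (simp only: mult_ac)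
      also have "\<dots> \<le> (1 + 4 * \<eta>) * ((1 + t) * min 1 y')"
        using \<eta> sq t y by (intro mult_right_mono) (auto simp: algebra_simps power2_eq_square)
      finally have "(1 + t') / min 1 y' \<le> (1 + 4 * \<eta>) * ((1 + t) / min 1 y)"
        using y by (simp add: divide_simps mult_ac)
      then show ?thesis using g' True by (simp add: g_def)
    next
      case False
      \<comment> \<open>\<open>t' \<le> y' \<le> y + \<eta>\<^sup>2 < t + \<eta>\<close> rules out
        the first alternative of \<open>alt\<close>.\<close>
      have cap: "t' = 1 / \<eta>"
        using alt False buy' near sq \<eta> by linarith
      have "4 \<le> 1 / \<eta>" using \<eta> by (simp add: field_simps)
      then have big: "4 \<le> t'" using cap by simp
      have "g t' y' = 1 + t'" using g' big buy' by simp
      moreover have "t' - \<eta> \<le> g t y"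
        using False near buy' sq big \<eta> y by (simp add: g_def max_eq)
      then have "(1 + 4 * \<eta>) * (t' - \<eta>) \<le> (1 + 4 * \<eta>) * g t y"
        using \<eta> by (intro mult_left_mono) auto
      \<comment> \<open>At the cap the relative slack \<open>4 * \<eta>\<close> amounts to about 4,
        which pays for the purchase price 1.\<close>
      moreover have "\<eta> * t' = 1" using cap \<eta> by simp
      then have "(1 + 4 * \<eta>) * (t' - \<eta>) = t' - \<eta> + 4 - 4 * \<eta>\<^sup>2"
        by (simp add: algebra_simps power2_eq_square)
      ultimately show ?thesis using sq \<eta> by linarith
    qed
  qed
qed

text \<open>Seasons more than \<open>\<eta>\<^sup>2\<close> apart are charged to their distance: the
  crude bound \<open>2 / \<eta>\<close> equals \<open>2 / \<eta>^3 * \<eta>\<^sup>2\<close>. The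
  resulting inequality holds for all pairs of positive seasons and can be integrated over a
  coupling.\<close>

lemma g_perturb:
  assumes \<eta>: "0 < \<eta>" "\<eta> \<le> 1/4" and t: "0 \<le> t" "\<eta> \<le> t'" "t' \<le> t + 2 * \<eta>" "t' \<le> 1 / \<eta>"
    and alt: "t + \<eta> \<le> t' \<or> t' = 1 / \<eta>" and y: "0 < y" "0 < y'"
  shows "g t' y' \<le> (1 + 4 * \<eta>) * g t y + 2 / \<eta>^3 * \<bar>y - y'\<bar>"
proof (cases "\<bar>y - y'\<bar> \<le> \<eta>\<^sup>2")
  case True
  then show ?thesis using g_perturb_near[of \<eta> t t' y y'] assms by (simp add: add_increasing2)
next
  case False
  have "g t' y' \<le> 2 / \<eta>" using g_bounds[of \<eta> t' y'] assms by simp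
  also have "\<dots> = 2 / \<eta>^3 * \<eta>\<^sup>2" using \<eta> by (simp add: field_simps power2_eq_square power3_eq_cube)
  also have "\<dots> \<le> 2 / \<eta>^3 * \<bar>y - y'\<bar>" using False \<eta> by (intro mult_left_mono) auto
  also have "\<dots> \<le> (1 + 4 * \<eta>) * g t y + 2 / \<eta>^3 * \<bar>y - y'\<bar>"
    using g_ge_1[of t y] \<eta> t y by simp
  finally show ?thesis .
qed

section \<open>Ratios of distributions that are close in earth mover distance\<close>

text \<open>This is what turns additive errors into relative ones: an error \<open>a\<close> is at
  most \<open>a\<close> times the expected ratio.\<close>

lemma nn_integral_g_ge_1:
  assumes "prob_space \<mu>" "AE y in \<mu>. 0 < y" "0 \<le> t"
  shows "1 \<le> (\<integral>\<^sup>+ y. ennreal (g t y) \<partial>\<mu>)"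
proof -
  interpret prob_space \<mu> by fact
  have "(\<integral>\<^sup>+ y. 1 \<partial>\<mu>) \<le> (\<integral>\<^sup>+ y. ennreal (g t y) \<partial>\<mu>)"
    by (rule nn_integral_mono_AE) (use assms g_ge_1 in auto)
  then show ?thesis by (simp add: emeasure_space_1)
qed

text \<open>Integrating \<open>g_perturb\<close> over a coupling of cost below
  \<open>\<eta>^4 / 2\<close> leaves an additive error of at most \<open>\<eta>\<close>, which
  becomes the fifth \<open>\<eta>\<close> in the factor because the expected ratio is at least
  1.\<close>

lemma nn_integral_g_perturb:
  assumes \<eta>: "0 < \<eta>" "\<eta> \<le> 1/4" and t: "0 \<le> t" "\<eta> \<le> t'" "t' \<le> t + 2 * \<eta>" "t' \<le> 1 / \<eta>"
    and alt: "t + \<eta> \<le> t' \<or> t' = 1 / \<eta>"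
    and pos: "AE y in \<mu>. 0 < y" "AE y in \<nu>. 0 < y"
    and emd: "EMD \<mu> \<nu> < ennreal (\<eta>^4 / 2)"
  shows "(\<integral>\<^sup>+ y. ennreal (g t' y) \<partial>\<nu>) \<le> ennreal (1 + 5 * \<eta>) * (\<integral>\<^sup>+ y. ennreal (g t y) \<partial>\<mu>)"
proof -
  \<comment> \<open>Strictness in \<open>emd\<close> yields a coupling of small cost without the
    infimum having to be attained.\<close>
  obtain J :: "(real \<times> real) measure" where J: "prob_space J"
      and sets_J[measurable_cong]: "sets J = sets (borel \<Otimes>\<^sub>M borel)"
      and marg: "distr J borel fst = \<mu>" "distr J borel snd = \<nu>"
      and cost: "(\<integral>\<^sup>+ z. ennreal \<bar>fst z - snd z\<bar> \<partial>J) < ennreal (\<eta>^4 / 2)"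
    using emd unfolding EMD_def INF_less_iff by auto
  interpret J: prob_space J by fact
  have "prob_space \<mu>" unfolding marg(1)[symmetric] by (rule J.prob_space_distr) measurable
  note g1 = nn_integral_g_ge_1[OF this pos(1) t(1)]
  have pos_J: "AE z in J. 0 < fst z" "AE z in J. 0 < snd z"
    using pos unfolding marg[symmetric] by (auto dest!: AE_distrD[rotated])
  have "(\<integral>\<^sup>+ y. ennreal (g t' y) \<partial>\<nu>) = (\<integral>\<^sup>+ z. ennreal (g t' (snd z)) \<partial>J)"
    unfolding marg(2)[symmetric] by (subst nn_integral_distr) auto
  also have "\<dots> \<le> (\<integral>\<^sup>+ z. ennreal (1 + 4 * \<eta>) * ennreal (g t (fst z))
      + ennreal (2 / \<eta>^3) * ennreal \<bar>fst z - snd z\<bar> \<partial>J)"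
  proof (rule nn_integral_mono_AE, use pos_J in eventually_elim)
    case (elim z)
    have "g t' (snd z) \<le> (1 + 4 * \<eta>) * g t (fst z) + 2 / \<eta>^3 * \<bar>fst z - snd z\<bar>"
      by (rule g_perturb) (use assms elim in auto)
    moreover have "0 \<le> g t (fst z)" using g_ge_1[of t "fst z"] elim t by simp
    ultimately show ?case using \<eta>
      by (simp flip: ennreal_mult ennreal_plus add: ennreal_leI)
  qed
  also have "\<dots> = ennreal (1 + 4 * \<eta>) * (\<integral>\<^sup>+ z. ennreal (g t (fst z)) \<partial>J)
      + ennreal (2 / \<eta>^3) * (\<integral>\<^sup>+ z. ennreal \<bar>fst z - snd z\<bar> \<partial>J)"
    by (subst nn_integral_add) (auto simp: nn_integral_cmult)
  also have "(\<integral>\<^sup>+ z. ennreal (g t (fst z)) \<partial>J) = (\<integral>\<^sup>+ y. ennreal (g t y) \<partial>\<mu>)"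
    unfolding marg(1)[symmetric] by (subst nn_integral_distr) auto
  also have "ennreal (2 / \<eta>^3) * (\<integral>\<^sup>+ z. ennreal \<bar>fst z - snd z\<bar> \<partial>J)
      \<le> ennreal (2 / \<eta>^3) * ennreal (\<eta>^4 / 2)"
    using cost by (intro mult_left_mono) auto
  also have "\<dots> = ennreal \<eta>"
    using \<eta> by (subst ennreal_mult[symmetric]) (auto simp: field_simps power4_eq_xxxx power3_eq_cube)
  also have "ennreal \<eta> \<le> ennreal \<eta> * (\<integral>\<^sup>+ y. ennreal (g t y) \<partial>\<mu>)"
    using mult_left_mono[OF g1, of "ennreal \<eta>"] by simp
  finally have "(\<integral>\<^sup>+ y. ennreal (g t' y) \<partial>\<nu>) \<le> (ennreal (1 + 4 * \<eta>) + ennreal \<eta>) * (\<integral>\<^sup>+ y. ennreal (g t y) \<partial>\<mu>)"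
    by (simp add: distrib_right add_left_mono)
  also have "ennreal (1 + 4 * \<eta>) + ennreal \<eta> = ennreal (1 + 5 * \<eta>)"
    using \<eta> by (subst ennreal_plus[symmetric]) (auto simp: algebra_simps)
  finally show ?thesis .
qed

section \<open>Disintegration of a joint distribution by a Markov kernel\<close>

text \<open>The kernel is given only through rectangles, which form an intersection-stable generator
  and so determine the measure. Written as a monadic bind, \<open>K\<close> becomes accessible to
  the general rules for integrals and almost sure statements.\<close>

lemma disintegration_eq_bind:
  assumes K: "prob_space K" and sets_K: "sets K = sets (M \<Otimes>\<^sub>M N)"
    and \<kappa>[measurable]: "\<kappa> \<in> M \<rightarrow>\<^sub>M prob_algebra N"
    and rect: "\<And>A B. A \<in> sets M \<Longrightarrow> B \<in> sets N \<Longrightarrow>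
      emeasure K (A \<times> B) = (\<integral>\<^sup>+ x \<in> A. emeasure (\<kappa> x) B \<partial>(distr K M fst))"
  shows "K = distr K M fst \<bind> (\<lambda>x. distr (\<kappa> x) (M \<Otimes>\<^sub>M N) (Pair x))" (is "K = ?B")
    and "(\<lambda>x. distr (\<kappa> x) (M \<Otimes>\<^sub>M N) (Pair x)) \<in> distr K M fst \<rightarrow>\<^sub>M subprob_algebra (M \<Otimes>\<^sub>M N)"
proof -
  interpret K: prob_space K by fact
  note [measurable_cong] = sets_K
  let ?\<kappa> = "\<lambda>x. distr (\<kappa> x) (M \<Otimes>\<^sub>M N) (Pair x)"
  have "?\<kappa> \<in> M \<rightarrow>\<^sub>M subprob_algebra (M \<Otimes>\<^sub>M N)"
    by (rule measurable_distr2[where M=N]) (auto intro: measurable_prob_algebraD)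
  then show \<kappa>': "?\<kappa> \<in> distr K M fst \<rightarrow>\<^sub>M subprob_algebra (M \<Otimes>\<^sub>M N)" by simp
  have "space K \<noteq> {}" by (rule K.not_empty)
  then have ne: "space (distr K M fst) \<noteq> {}"
    using sets_eq_imp_space_eq[OF sets_K] by (auto simp: space_pair_measure)
  have sets_B: "sets ?B = sets (M \<Otimes>\<^sub>M N)"
    by (rule sets_bind) (use ne in auto)
  have eq: "emeasure K (A \<times> B) = emeasure ?B (A \<times> B)" if [measurable]: "A \<in> sets M" "B \<in> sets N" for A B
  proof -
    have "emeasure ?B (A \<times> B) = (\<integral>\<^sup>+ x. emeasure (?\<kappa> x) (A \<times> B) \<partial>(distr K M fst))"
      by (rule emeasure_bind[OF ne \<kappa>']) measurable
    also have "\<dots> = (\<integral>\<^sup>+ x \<in> A. emeasure (\<kappa> x) B \<partial>(distr K M fst))"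
    proof (rule nn_integral_cong)
      fix x assume "x \<in> space (distr K M fst)"
      then have x: "x \<in> space M" by simp
      have sets_x[measurable_cong]: "sets (\<kappa> x) = sets N"
        using measurable_space[OF \<kappa> x] by (simp add: space_prob_algebra)
      have "emeasure (?\<kappa> x) (A \<times> B) = emeasure (\<kappa> x) (Pair x -` (A \<times> B) \<inter> space (\<kappa> x))"
        using x by (intro emeasure_distr) auto
      also have "Pair x -` (A \<times> B) \<inter> space (\<kappa> x) = (if x \<in> A then B else {})"
        using sets.sets_into_space[OF that(2)] sets_eq_imp_space_eq[OF sets_x] by auto
      finally show "emeasure (?\<kappa> x) (A \<times> B) = emeasure (\<kappa> x) B * indicator A x"
        by (simp split: if_splits)
    qed
    finally show ?thesis using rect[OF that] by simp
  qed
  show "K = ?B"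
  proof (rule measure_eqI_generator_eq[OF Int_stable_pair_measure_generator[of M N]])
    show "{a \<times> b |a b. a \<in> sets M \<and> b \<in> sets N} \<subseteq> Pow (space M \<times> space N)"
      by (rule pair_measure_closed)
    show "sets K = sigma_sets (space M \<times> space N) {a \<times> b |a b. a \<in> sets M \<and> b \<in> sets N}"
      "sets ?B = sigma_sets (space M \<times> space N) {a \<times> b |a b. a \<in> sets M \<and> b \<in> sets N}"
      using sets_K sets_B by (simp_all only: sets_pair_measure)
    show "range (\<lambda>_::nat. space M \<times> space N) \<subseteq> {a \<times> b |a b. a \<in> sets M \<and> b \<in> sets N}" by auto
    show "emeasure K (space M \<times> space N) \<noteq> \<infinity>" by (simp add: K.emeasure_finite)
  qed (use eq in auto)
qed

lemma
  assumes K: "prob_space K" and sets_K: "sets K = sets (M \<Otimes>\<^sub>M N)"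
    and \<kappa>[measurable]: "\<kappa> \<in> M \<rightarrow>\<^sub>M prob_algebra N"
    and rect: "\<And>A B. A \<in> sets M \<Longrightarrow> B \<in> sets N \<Longrightarrow>
      emeasure K (A \<times> B) = (\<integral>\<^sup>+ x \<in> A. emeasure (\<kappa> x) B \<partial>(distr K M fst))"
  shows nn_integral_disintegration: "f \<in> borel_measurable (M \<Otimes>\<^sub>M N) \<Longrightarrow>
      (\<integral>\<^sup>+ z. f z \<partial>K) = (\<integral>\<^sup>+ x. \<integral>\<^sup>+ y. f (x, y) \<partial>\<kappa> x \<partial>(distr K M fst))"
    and AE_disintegration: "Measurable.pred (M \<Otimes>\<^sub>M N) Q \<Longrightarrow>
      (AE z in K. Q z) \<longleftrightarrow> (AE x in distr K M fst. AE y in \<kappa> x. Q (x, y))"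
proof -
  let ?B = "distr K M fst \<bind> (\<lambda>x. distr (\<kappa> x) (M \<Otimes>\<^sub>M N) (Pair x))"
  note bind = disintegration_eq_bind[OF assms]
  have Pair: "Pair x \<in> \<kappa> x \<rightarrow>\<^sub>M M \<Otimes>\<^sub>M N" if x: "x \<in> space M" for x
  proof -
    have [measurable_cong]: "sets (\<kappa> x) = sets N"
      using measurable_space[OF \<kappa> x] by (simp add: space_prob_algebra)
    show ?thesis using x by measurable
  qed
  show "(\<integral>\<^sup>+ z. f z \<partial>K) = (\<integral>\<^sup>+ x. \<integral>\<^sup>+ y. f (x, y) \<partial>\<kappa> x \<partial>(distr K M fst))"
    if f: "f \<in> borel_measurable (M \<Otimes>\<^sub>M N)"
  proof -
    have "(\<integral>\<^sup>+ z. f z \<partial>K) = (\<integral>\<^sup>+ z. f z \<partial>?B)" using bind(1) by (rule arg_cong)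
    also have "\<dots> = (\<integral>\<^sup>+ x. \<integral>\<^sup>+ z. f z \<partial>distr (\<kappa> x) (M \<Otimes>\<^sub>M N) (Pair x) \<partial>(distr K M fst))"
      by (rule nn_integral_bind[OF f bind(2)])
    also have "\<dots> = (\<integral>\<^sup>+ x. \<integral>\<^sup>+ y. f (x, y) \<partial>\<kappa> x \<partial>(distr K M fst))"
      by (rule nn_integral_cong) (simp add: nn_integral_distr Pair f)
    finally show ?thesis .
  qed
  show "(AE z in K. Q z) \<longleftrightarrow> (AE x in distr K M fst. AE y in \<kappa> x. Q (x, y))"
    if Q[measurable]: "Measurable.pred (M \<Otimes>\<^sub>M N) Q"
  proof -
    have "(AE z in K. Q z) \<longleftrightarrow> (AE z in ?B. Q z)" using bind(1) by (rule arg_cong)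
    also have "\<dots> \<longleftrightarrow> (AE x in distr K M fst. AE z in distr (\<kappa> x) (M \<Otimes>\<^sub>M N) (Pair x). Q z)"
      by (rule AE_bind[OF bind(2) Q])
    also have "\<dots> \<longleftrightarrow> (AE x in distr K M fst. AE y in \<kappa> x. Q (x, y))"
      by (rule AE_cong) (simp add: AE_distr_iff Pair)
    finally show ?thesis .
  qed
qed

section \<open>Thresholds that are constant on grid cells\<close>

text \<open>With \<open>\<eta> = 1 / q\<close> this is the grid of mesh \<open>\<eta>\<close> in
  \<open>[\<eta>, 1 / \<eta>]\<close>, the range covered by \<open>g_bounds\<close>.\<close>

definition threshold_grid :: "nat \<Rightarrow> real set" where
  "threshold_grid q = (\<lambda>k. real k / real q) ` {1..q\<^sup>2}"

lemma finite_threshold_grid[simp]: "finite (threshold_grid q)"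
  by (simp add: threshold_grid_def)

lemma threshold_grid_nonempty: "0 < q \<Longrightarrow> threshold_grid q \<noteq> {}"
  by (auto simp: threshold_grid_def Suc_le_eq)

lemma threshold_grid_bounds:
  assumes "0 < q" "t \<in> threshold_grid q"
  shows "1 / real q \<le> t" "t \<le> real q"
proof -
  obtain k where k: "t = real k / real q" "1 \<le> k" "k \<le> q\<^sup>2"
    using assms by (auto simp: threshold_grid_def)
  show "1 / real q \<le> t" using k assms by (simp add: divide_right_mono)
  have "real k \<le> real q * real q"
    using k(3) by (metis of_nat_le_iff of_nat_mult power2_eq_square)
  then show "t \<le> real q" using assms by (simp add: k(1) pos_divide_le_eq)
qed

text \<open>The conclusions are the hypotheses of \<open>g_perturb\<close> on the shifted threshold,
  for \<open>\<eta> = 1 / q\<close>.\<close>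

lemma threshold_grid_approx:
  assumes q: "0 < q" and t: "0 \<le> t"
  obtains t' where "t' \<in> threshold_grid q" "t' \<le> t + 2 / real q"
    "t + 1 / real q \<le> t' \<or> t' = real q"
proof -
  \<comment> \<open>Rounding up alone may not move \<open>t\<close> at all; the extra 1 forces a
    shift of at least one mesh width.\<close>
  define k where "k = nat \<lceil>t * real q\<rceil> + 1"
  have "0 \<le> t * real q" using t by simp
  then have nn: "0 \<le> \<lceil>t * real q\<rceil>" by linarith
  have k: "t * real q + 1 \<le> real k" "real k \<le> t * real q + 2"
    unfolding k_def using nn by (simp_all add: of_nat_nat) linarith+
  show ?thesis
  proof (cases "k \<le> q\<^sup>2")
    case True
    moreover have "1 \<le> k" by (simp add: k_def)
    ultimately have "real k / real q \<in> threshold_grid q"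
      unfolding threshold_grid_def by (intro imageI) simp
    moreover have "real k / real q \<le> (t * real q + 2) / real q" "(t * real q + 1) / real q \<le> real k / real q"
      using k by (auto intro: divide_right_mono)
    then have "real k / real q \<le> t + 2 / real q" "t + 1 / real q \<le> real k / real q"
      using q by (simp_all add: add_divide_distrib)
    ultimately show ?thesis using that by blast
  next
    case False
    have "real (q\<^sup>2) \<le> t * real q + 2"
      using False k by linarith
    then have "real q \<le> t + 2 / real q"
      using q by (simp add: field_simps power2_eq_square)
    moreover have "real q \<in> threshold_grid q"
      using q by (auto simp: threshold_grid_def power2_eq_square intro!: image_eqI[of _ _ "q\<^sup>2"])
    ultimately show ?thesis using that by blast
  qed
qed

text \<open>The minimum only matters outside the cube; it makes the range of \<open>cell\<close> finite.\<close>

definition cell :: "nat \<Rightarrow> nat \<Rightarrow> (nat \<Rightarrow> real) \<Rightarrow> nat \<Rightarrow> nat" where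
  "cell d N x = (\<lambda>i\<in>{..<d}. min N (nat \<lfloor>real N * x i\<rfloor>))"

lemma cell_in_PiE: "cell d N x \<in> {..<d} \<rightarrow>\<^sub>E {..N}"
  by (auto simp: cell_def)

text \<open>A finite product of countable discrete spaces is discrete, so every function of the cell
  is measurable.\<close>

lemma measurable_cell: "cell d N \<in> Xsp d \<rightarrow>\<^sub>M count_space ({..<d} \<rightarrow>\<^sub>E UNIV)"
proof -
  have "cell d N \<in> Xsp d \<rightarrow>\<^sub>M PiM {..<d} (\<lambda>_. count_space UNIV)"
    unfolding cell_def Xsp_def by measurable
  then show ?thesis by (simp add: count_space_PiM_finite)
qed

text \<open>Inside the cube the cap in \<open>cell\<close> is inactive, so equal cells mean equal
  floors and coordinates at most \<open>1 / N\<close> apart; the bound is the diagonal of the grid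
  cell.\<close>

lemma dist_d_same_cell:
  assumes x: "x \<in> cube d" "x' \<in> cube d" and eq: "cell d N x = cell d N x'" and N: "0 < N"
  shows "dist_d d x x' \<le> sqrt (real d) / real N"
proof -
  have "(x i - x' i)\<^sup>2 \<le> (1 / real N)\<^sup>2" if i: "i < d" for i
  proof -
    have bnds: "0 \<le> z i \<and> z i \<le> 1" if "z \<in> cube d" for z using that i by (auto simp: cube_def PiE_iff)
    have fl: "int (cell d N z i) = \<lfloor>real N * z i\<rfloor>" if "z \<in> cube d" for z
    proof -
      have "0 \<le> \<lfloor>real N * z i\<rfloor>" using bnds[OF that] by simp
      moreover have "real N * z i \<le> real N" using bnds[OF that] by (simp add: mult_left_le)
      then have "\<lfloor>real N * z i\<rfloor> \<le> int N" by (simp add: floor_le_iff)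
      ultimately show ?thesis using i by (simp add: cell_def)
    qed
    have "\<lfloor>real N * x i\<rfloor> = \<lfloor>real N * x' i\<rfloor>" using fl[OF x(1)] fl[OF x(2)] eq by simp
    then have "\<bar>real N * x i - real N * x' i\<bar> \<le> 1" by linarith
    then have "real N * \<bar>x i - x' i\<bar> \<le> 1" by (simp add: abs_mult flip: right_diff_distrib)
    then have "\<bar>x i - x' i\<bar> \<le> 1 / real N" using N by (simp add: field_simps)
    then show ?thesis by (rule abs_le_square_iff[THEN iffD1, rotated, of "x i - x' i" "1 / real N", simplified])
  qed
  then have "(\<Sum>i<d. (x i - x' i)\<^sup>2) \<le> (\<Sum>i<d. (1 / real N)\<^sup>2)" by (intro sum_mono) auto
  then have "dist_d d x x' \<le> sqrt (real d * (1 / real N)\<^sup>2)" unfolding dist_d_def by (intro real_sqrt_le_mono) simp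
  then show ?thesis by (simp add: real_sqrt_mult)
qed

text \<open>Taking extensional functions on the finite set of cell indices makes the class finite,
  with a cardinality given by counting them.\<close>

definition cell_thresholds :: "nat \<Rightarrow> nat \<Rightarrow> nat \<Rightarrow> ((nat \<Rightarrow> real) \<Rightarrow> real) set" where
  "cell_thresholds d N q =
    (\<lambda>f x. f (cell d N x)) ` (({..<d} \<rightarrow>\<^sub>E {..N}) \<rightarrow>\<^sub>E threshold_grid q)"

lemma finite_cell_thresholds: "finite (cell_thresholds d N q)"
  unfolding cell_thresholds_def by (intro finite_imageI finite_PiE) auto

lemma card_threshold_grid: "card (threshold_grid q) \<le> q\<^sup>2"
  unfolding threshold_grid_def by (metis card_atLeastAtMost card_image_le diff_Suc_1 finite_atLeastAtMost)

lemma card_cell_thresholds: "card (cell_thresholds d N q) \<le> (q\<^sup>2) ^ (N + 1) ^ d"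
proof -
  have "card (cell_thresholds d N q) \<le> card (({..<d} \<rightarrow>\<^sub>E {..N}) \<rightarrow>\<^sub>E threshold_grid q)"
    unfolding cell_thresholds_def by (intro card_image_le finite_PiE) auto
  also have "\<dots> = card (threshold_grid q) ^ (N + 1) ^ d"
    by (simp add: card_PiE finite_PiE)
  also have "\<dots> \<le> (q\<^sup>2) ^ (N + 1) ^ d"
    by (intro power_mono card_threshold_grid) simp
  finally show ?thesis .
qed

lemma cell_thresholds_nonempty: "0 < q \<Longrightarrow> cell_thresholds d N q \<noteq> {}"
  unfolding cell_thresholds_def using threshold_grid_nonempty by (simp add: PiE_eq_empty_iff)

lemma cell_thresholds_range: "h \<in> cell_thresholds d N q \<Longrightarrow> h x \<in> threshold_grid q"
  unfolding cell_thresholds_def using cell_in_PiE by fastforce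

lemma cell_thresholds_measurable: "h \<in> cell_thresholds d N q \<Longrightarrow> h \<in> borel_measurable (Xsp d)"
  unfolding cell_thresholds_def
  by (auto intro!: measurable_compose[OF measurable_cell])

lemma cell_thresholds_subset:
  assumes "0 < q" shows "cell_thresholds d N q \<subseteq> threshold_fns d"
proof
  fix h assume h: "h \<in> cell_thresholds d N q"
  have "0 \<le> h x" for x
    using threshold_grid_bounds(1)[OF assms cell_thresholds_range[OF h, of x]] by (smt (verit) divide_nonneg_nonneg of_nat_0_le_iff)
  then show "h \<in> threshold_fns d" using cell_thresholds_measurable[OF h] by (simp add: threshold_fns_def)
qed

lemma AE_joint_dist:
  assumes "joint_dist d K"
  shows "AE z in K. fst z \<in> cube d \<and> 0 < snd z"
proof -
  interpret prob_space K using assms by (simp add: joint_dist_def)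
  have "prob (cube d \<times> {0<..}) = 1" using assms by (simp add: joint_dist_def measure_def)
  then have "AE z in K. z \<in> cube d \<times> {0<..}"
    by (rule AE_prob_1)
  then show ?thesis by eventually_elim auto
qed

lemma ecr_ge_1:
  assumes K: "joint_dist d K" and \<theta>: "\<theta> \<in> threshold_fns d"
  shows "1 \<le> ecr K \<theta>"
proof -
  interpret prob_space K using K by (simp add: joint_dist_def)
  have "(\<integral>\<^sup>+ z. 1 \<partial>K) \<le> ecr K \<theta>" unfolding ecr_def
    by (rule nn_integral_mono_AE, use AE_joint_dist[OF K] in eventually_elim)
       (use \<theta> g_ge_1 in \<open>auto simp: threshold_fns_def\<close>)
  then show ?thesis by (simp add: emeasure_space_1)
qed

lemma pred_cube[measurable]: "Measurable.pred (Xsp d) (\<lambda>x. x \<in> cube d)"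
proof -
  have "cube d \<in> sets (Xsp d)" unfolding cube_def Xsp_def by (rule sets_PiM_I_finite) auto
  then show ?thesis by simp
qed

text \<open>In every cell the shift of the best grid threshold at one point of the cell is nearly optimal
  at all points of the cell.\<close>

lemma cell_thresholds_approx:
  assumes K: "joint_dist d K" and lip: "lipschitz_dist d L K" and "0 < L" "0 < N" and q: "4 \<le> q"
    and fine: "L * sqrt (real d) / real N < (1 / real q)^4 / 2" and \<theta>: "\<theta> \<in> threshold_fns d"
  shows "\<exists>h\<in>cell_thresholds d N q. ecr K h \<le> ennreal ((1 + 5 / real q)\<^sup>2) * ecr K \<theta>"
proof -
  have prob_K: "prob_space K" and sets_K: "sets K = sets (Xsp d \<Otimes>\<^sub>M borel)"
    using K by (auto simp: joint_dist_def)
  obtain \<kappa> where \<kappa>[measurable]: "\<kappa> \<in> Xsp d \<rightarrow>\<^sub>M prob_algebra borel"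
    and rect: "\<And>A B. A \<in> sets (Xsp d) \<Longrightarrow> B \<in> sets borel \<Longrightarrow>
        emeasure K (A \<times> B) = (\<integral>\<^sup>+ x \<in> A. emeasure (\<kappa> x) B \<partial>(distr K (Xsp d) fst))"
    and emd: "\<And>x1 x2. x1 \<in> cube d \<Longrightarrow> x2 \<in> cube d \<Longrightarrow>
        EMD (\<kappa> x1) (\<kappa> x2) \<le> ennreal (L * dist_d d x1 x2)"
    using lip unfolding lipschitz_dist_def by blast
  note nn_dis = nn_integral_disintegration[OF prob_K sets_K \<kappa> rect]
  \<comment> \<open>The Lipschitz condition holds at all points of the cube, but positive seasons
    are guaranteed only at almost every point; \<open>G\<close> collects the points having
    both.\<close>
  define G where "G = {x \<in> cube d. AE y in \<kappa> x. 0 < y}"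
  define F where "F t x = (\<integral>\<^sup>+ y. ennreal (g t y) \<partial>\<kappa> x)" for t x
  define c where "c = ennreal (1 + 5 / real q)"
  have "AE x in distr K (Xsp d) fst. AE y in \<kappa> x. x \<in> cube d \<and> 0 < y"
    using AE_joint_dist[OF K] by (subst (asm) AE_disintegration[OF prob_K sets_K \<kappa> rect]) auto
  then have AE_G: "AE x in distr K (Xsp d) fst. x \<in> G"
  proof (rule AE_mp, intro AE_I2 impI)
    fix x assume x: "x \<in> space (distr K (Xsp d) fst)" and AE: "AE y in \<kappa> x. x \<in> cube d \<and> 0 < y"
    interpret prob_space "\<kappa> x"
      using measurable_space[OF \<kappa>, of x] x by (simp add: space_prob_algebra)
    \<comment> \<open>On a probability space an almost sure statement holds somewhere, which frees
      \<open>x \<in> cube d\<close> from the quantifier over \<open>y\<close>.\<close>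
    show "x \<in> G" using AE AE_E_prob by (auto simp: G_def)
  qed
  \<comment> \<open>The shifted threshold depends on \<open>t\<close> alone, not on the two points,
    so one function \<open>sh\<close> serves every cell and both directions.\<close>
  have "\<exists>t'\<in>threshold_grid q. \<forall>x\<in>G. \<forall>x'\<in>G. cell d N x = cell d N x' \<longrightarrow> F t' x' \<le> c * F t x"
    if t: "0 \<le> t" for t
  proof -
    obtain t' where t': "t' \<in> threshold_grid q" "t' \<le> t + 2 / real q"
        "t + 1 / real q \<le> t' \<or> t' = real q"
      using threshold_grid_approx[of q t] t q by auto
    have "F t' x' \<le> c * F t x" if x: "x \<in> G" "x' \<in> G" "cell d N x = cell d N x'" for x x'
    proof -
      have "L * dist_d d x x' \<le> L * (sqrt (real d) / real N)"
        using x \<open>0 < L\<close> \<open>0 < N\<close> by (intro mult_left_mono dist_d_same_cell) (auto simp: G_def)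
      then have "L * dist_d d x x' < (1 / real q)^4 / 2"
        using fine unfolding times_divide_eq_right by (rule le_less_trans)
      then have "ennreal (L * dist_d d x x') < ennreal ((1 / real q)^4 / 2)"
        using q by (intro ennreal_lessI) auto
      then have "EMD (\<kappa> x) (\<kappa> x') < ennreal ((1 / real q)^4 / 2)"
        using emd[of x x'] x by (auto simp: G_def)
      then have "F t' x' \<le> ennreal (1 + 5 * (1 / real q)) * F t x"
        unfolding F_def
        using x t q t' threshold_grid_bounds[of q t']
        by (intro nn_integral_g_perturb) (auto simp: G_def field_simps)
      then show ?thesis by (simp add: c_def)
    qed
    then show ?thesis using t' by blast
  qed
  then obtain sh where sh: "\<And>t. 0 \<le> t \<Longrightarrow> sh t \<in> threshold_grid q"
    "\<And>t x x'. 0 \<le> t \<Longrightarrow> x \<in> G \<Longrightarrow> x' \<in> G \<Longrightarrow> cell d N x = cell d N x' \<Longrightarrow> F (sh t) x' \<le> c * F t x"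
    by metis
  have "\<exists>t\<in>threshold_grid q. \<forall>x\<in>G. cell d N x = j \<longrightarrow> (\<forall>u\<ge>0. F t x \<le> c\<^sup>2 * F u x)" for j
  proof (cases "\<exists>x0\<in>G. cell d N x0 = j")
    \<comment> \<open>Cells that miss \<open>G\<close> get an arbitrary grid threshold.\<close>
    case False
    then show ?thesis using threshold_grid_nonempty[of q] q by fastforce
  next
    case True
    then obtain x0 where x0: "x0 \<in> G" "cell d N x0 = j" by blast
    \<comment> \<open>A minimum over the finite grid surely exists. A competitor \<open>u\<close> at
      \<open>x\<close> is compared through its shift \<open>sh u\<close> at \<open>x0\<close>, and
      \<open>t0\<close> is shifted again to return to \<open>x\<close>; each passage costs one
      factor \<open>c\<close>.\<close>
    define t0 where "t0 = arg_min_on (\<lambda>t. F t x0) (threshold_grid q)"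
    have ne: "threshold_grid q \<noteq> {}" using threshold_grid_nonempty q by simp
    have t0: "t0 \<in> threshold_grid q"
      unfolding t0_def by (rule arg_min_if_finite(1)[OF finite_threshold_grid ne])
    then have t0_nn: "0 \<le> t0"
      using threshold_grid_bounds(1)[of q t0] q by (smt (verit) divide_nonneg_nonneg of_nat_0_le_iff gr0I not_numeral_le_zero)
    have "F (sh t0) x \<le> c\<^sup>2 * F u x" if x: "x \<in> G" "cell d N x = j" and u: "0 \<le> u" for x u
    proof -
      have "F t0 x0 \<le> F (sh u) x0"
        unfolding t0_def by (rule arg_min_least[OF finite_threshold_grid ne sh(1)[OF u]])
      also have "\<dots> \<le> c * F u x" using sh(2)[OF u x(1) x0(1)] x x0 by simp
      finally have "c * F t0 x0 \<le> c * (c * F u x)" by (rule mult_left_mono) simp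
      moreover have "F (sh t0) x \<le> c * F t0 x0" using sh(2)[OF t0_nn x0(1) x(1)] x x0 by simp
      ultimately show ?thesis by (simp add: power2_eq_square mult_ac)
    qed
    then show ?thesis using sh(1)[OF t0_nn] by blast
  qed
  then obtain T where T: "\<And>j. T j \<in> threshold_grid q"
    "\<And>x u. x \<in> G \<Longrightarrow> 0 \<le> u \<Longrightarrow> F (T (cell d N x)) x \<le> c\<^sup>2 * F u x"
    by metis
  define h where "h = (\<lambda>x. T (cell d N x))"
  \<comment> \<open>Restricting \<open>T\<close> to the possible cell indices does not change
    \<open>h\<close> and supplies the extensionality that the class demands.\<close>
  have "h = (\<lambda>x. (\<lambda>j\<in>{..<d} \<rightarrow>\<^sub>E {..N}. T j) (cell d N x))"
    using cell_in_PiE by (auto simp: h_def)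
  then have h: "h \<in> cell_thresholds d N q"
    unfolding cell_thresholds_def 
    by (rule image_eqI[where x = "restrict T ({..<d} \<rightarrow>\<^sub>E {..N})"]) (use T(1) in simp_all)
  note [measurable] = cell_thresholds_measurable[OF h]
  have [measurable]: "\<theta> \<in> borel_measurable (Xsp d)" using \<theta> by (simp add: threshold_fns_def)
  have "ecr K h = (\<integral>\<^sup>+ x. F (h x) x \<partial>(distr K (Xsp d) fst))"
    unfolding ecr_def F_def by (subst nn_dis) auto
  also have "\<dots> \<le> (\<integral>\<^sup>+ x. \<integral>\<^sup>+ y. c\<^sup>2 * ennreal (g (\<theta> x) y) \<partial>\<kappa> x \<partial>(distr K (Xsp d) fst))"
  proof (rule nn_integral_mono_AE, use AE_G AE_space in eventually_elim)
    case (elim x)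
    then have [measurable_cong]: "sets (\<kappa> x) = sets borel"
      using measurable_space[OF \<kappa>, of x] by (simp add: space_prob_algebra)
    have "F (h x) x \<le> c\<^sup>2 * F (\<theta> x) x"
      unfolding h_def by (rule T(2)) (use elim \<theta> in \<open>auto simp: G_def threshold_fns_def\<close>)
    then show ?case unfolding F_def by (simp add: nn_integral_cmult)
  qed
  also have "\<dots> = (\<integral>\<^sup>+ z. c\<^sup>2 * ennreal (g (\<theta> (fst z)) (snd z)) \<partial>K)"
    by (subst nn_dis) auto
  also have "\<dots> = c\<^sup>2 * ecr K \<theta>"
    unfolding ecr_def using sets_K by (intro nn_integral_cmult) (simp cong: measurable_cong_sets)
  also have "c\<^sup>2 = ennreal ((1 + 5 / real q)\<^sup>2)"
    unfolding c_def by (rule ennreal_power) simp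
  finally show ?thesis using h by blast
qed

section \<open>Accuracy of the empirical minimiser\<close>

lemma cell_thresholds_loss:
  assumes q: "0 < q" and sets_K: "sets K = sets (Xsp d \<Otimes>\<^sub>M borel)" and h: "h \<in> cell_thresholds d N q"
  shows "(\<lambda>z. g (h (fst z)) (snd z)) \<in> borel_measurable K"
    and "g (h (fst z)) (snd z) \<in> {0..2 * real q}"
proof -
  note [measurable] = cell_thresholds_measurable[OF h]
  note [measurable_cong] = sets_K
  show "(\<lambda>z. g (h (fst z)) (snd z)) \<in> borel_measurable K" by measurable
  show "g (h (fst z)) (snd z) \<in> {0..2 * real q}"
    using g_bounds[of "1 / real q" "h (fst z)" "snd z"] q
      threshold_grid_bounds[OF q cell_thresholds_range[OF h, of "fst z"]] by simp
qed

text \<open>Losses in the class are bounded, which links the extended expectation in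
  \<open>accurate\<close> to the real mean in the Hoeffding bound.\<close>

lemma ecr_eq_integral:
  assumes q: "0 < q" and K: "joint_dist d K" and h: "h \<in> cell_thresholds d N q"
  shows "ecr K h = ennreal (\<integral>z. g (h (fst z)) (snd z) \<partial>K)"
    and "0 \<le> (\<integral>z. g (h (fst z)) (snd z) \<partial>K)"
proof -
  interpret prob_space K using K by (simp add: joint_dist_def)
  note loss = cell_thresholds_loss[OF q _ h, of K]
  have "integrable K (\<lambda>z. g (h (fst z)) (snd z))"
    by (rule integrable_const_bound[where B="2 * real q"]) (use loss K in \<open>auto simp: joint_dist_def\<close>)
  then show "ecr K h = ennreal (\<integral>z. g (h (fst z)) (snd z) \<partial>K)"
    unfolding ecr_def by (rule nn_integral_eq_integral) (use loss K in \<open>auto simp: joint_dist_def\<close>)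
  show "0 \<le> (\<integral>z. g (h (fst z)) (snd z) \<partial>K)"
    by (rule integral_nonneg_AE) (use loss K in \<open>auto simp: joint_dist_def\<close>)
qed

text \<open>Multiplication by a positive finite constant is invertible, so it passes through the
  infimum; no optimal threshold function has to exist.\<close>

lemma ennreal_le_mult_INF:
  fixes f :: "'a \<Rightarrow> ennreal"
  assumes "0 < r" and le: "\<And>i. i \<in> I \<Longrightarrow> x \<le> ennreal r * f i"
  shows "x \<le> ennreal r * (INF i\<in>I. f i)"
proof -
  have inv: "ennreal (1 / r) * (ennreal r * a) = a" "ennreal r * (ennreal (1 / r) * a) = a" for a
    using \<open>0 < r\<close> by (simp_all flip: mult.assoc ennreal_mult)
  have "ennreal (1 / r) * x \<le> (INF i\<in>I. f i)"
    by (rule INF_greatest) (use mult_left_mono[OF le, of _ "ennreal (1 / r)"] inv in simp)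
  from mult_left_mono[OF this, of "ennreal r"] show ?thesis by (simp add: inv)
qed

text \<open>Sample size: with accuracy \<open>1 / q\<close>, losses in \<open>{0..2 * q}\<close> and this \<open>n\<close>, the Hoeffding exponent is
  \<open>1 + (N + 1) ^ d * q\<^sup>2 + d * q\<close>; its three terms pay for the factor 2, for the union bound, and for
  the failure probability.\<close>

lemma learn_cell_thresholds:
  assumes "0 < L" "0 < \<epsilon>" "0 < N" and q: "25 \<le> q" "13 / \<epsilon> \<le> real q"
    and fine: "L * sqrt (real d) / real N < (1 / real q)^4 / 2"
    and n: "n = 2 * q^4 * (1 + (N + 1) ^ d * q\<^sup>2 + d * q)"
    and K: "joint_dist d K" and lip: "lipschitz_dist d L K"
  shows "\<exists>S \<in> sets (PiM {..<n} (\<lambda>_. K)).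
           measure (PiM {..<n} (\<lambda>_. K)) S \<ge> 1 - \<epsilon> powr real d \<and>
           (\<forall>s\<in>S. accurate d \<epsilon> K (erm (\<lambda>h z. g (h (fst z)) (snd z)) (cell_thresholds d N q) n s))"
proof -
  let ?H = "cell_thresholds d N q" and ?loss = "\<lambda>h (z :: (nat \<Rightarrow> real) \<times> real). g (h (fst z)) (snd z)"
  define \<eta> where "\<eta> = 1 / real q"
  have q0: "0 < q" using q by simp
  have \<eta>: "0 < \<eta>" "\<eta> \<le> 1 / 25" unfolding \<eta>_def using q by (auto simp: field_simps)
  \<comment> \<open>The 13 covers \<open>(1 + 5 * \<eta>)\<^sup>2 + 2 * \<eta>\<close>: 10 and 2
    from the linear terms, and 1 from \<open>25 * \<eta>\<^sup>2 \<le> \<eta>\<close>.\<close>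
  have \<epsilon>\<eta>: "13 * \<eta> \<le> \<epsilon>" unfolding \<eta>_def using q q0 \<open>0 < \<epsilon>\<close> by (simp add: field_simps)
  define m where "m = 1 + (N + 1) ^ d * q\<^sup>2 + d * q"
  have n': "n = 2 * q^4 * m" "0 < n" using n q0 by (auto simp: m_def)
  have "real (card ?H) \<le> real ((q\<^sup>2) ^ (N + 1) ^ d)"
    using card_cell_thresholds by (rule of_nat_mono)
  also have "\<dots> = real (q\<^sup>2) ^ (N + 1) ^ d" by (rule of_nat_power)
  \<comment> \<open>This crude bound puts the cardinality into an exponent that is a summand of
    \<open>m\<close>, and keeps logarithms out of the sample size.\<close>
  also have "\<dots> \<le> exp (real (q\<^sup>2)) ^ (N + 1) ^ d"
    by (intro power_mono less_imp_le[OF exp_gt_self]) simp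
  also have "\<dots> = exp (real ((N + 1) ^ d * q\<^sup>2))"
    unfolding of_nat_mult by (rule exp_of_nat_mult[symmetric])
  finally have card: "real (card ?H) \<le> exp (real ((N + 1) ^ d * q\<^sup>2))" .
  have two: "(2::real) \<le> exp 1" using exp_ge_add_one_self[of 1] by simp
  have expo: "- 2 * real n * \<eta>\<^sup>2 / (2 * real q)\<^sup>2 = - real m"
    unfolding n' \<eta>_def using q0 by (simp add: field_simps power2_eq_square power4_eq_xxxx)
  have "2 * real (card ?H) * exp (- 2 * real n * \<eta>\<^sup>2 / (2 * real q)\<^sup>2)
      \<le> exp 1 * exp (real ((N + 1) ^ d * q\<^sup>2)) * exp (- real m)"
    unfolding expo by (intro mult_mono two card) auto
  also have "\<dots> = exp (- (real d * real q))"
    unfolding exp_add[symmetric] m_def by simp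
  also have "\<dots> \<le> \<epsilon> powr real d"
  proof -
    \<comment> \<open>Since \<open>ln (1 / \<epsilon>) \<le> q\<close>, the summand
      \<open>d * q\<close> of the exponent yields \<open>\<epsilon>\<close> to the power
      \<open>d\<close>.\<close>
    have "ln (1 / \<epsilon>) \<le> 1 / \<epsilon>" using ln_le_minus_one[of "1 / \<epsilon>"] \<open>0 < \<epsilon>\<close> by simp
    also have "\<dots> \<le> 13 / \<epsilon>" using \<open>0 < \<epsilon>\<close> by (simp add: divide_right_mono)
    finally have "- ln \<epsilon> \<le> real q" using q \<open>0 < \<epsilon>\<close> by (simp add: ln_div)
    then have "real d * - ln \<epsilon> \<le> real d * real q" by (intro mult_left_mono) auto
    then show ?thesis using \<open>0 < \<epsilon>\<close> by (simp add: powr_def)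
  qed
  finally have fail: "2 * real (card ?H) * exp (- 2 * real n * \<eta>\<^sup>2 / (2 * real q)\<^sup>2) \<le> \<epsilon> powr real d" .
  have sets_K: "sets K = sets (Xsp d \<Otimes>\<^sub>M borel)" and prob_K: "prob_space K"
    using K by (auto simp: joint_dist_def)
  obtain S where S: "S \<in> sets (PiM {..<n} (\<lambda>_. K))"
      "measure (PiM {..<n} (\<lambda>_. K)) S \<ge> 1 - 2 * real (card ?H) * exp (- 2 * real n * \<eta>\<^sup>2 / (2 * real q)\<^sup>2)"
      "\<And>s. s \<in> S \<Longrightarrow> erm ?loss ?H n s \<in> ?H"
      "\<And>s h. s \<in> S \<Longrightarrow> h \<in> ?H \<Longrightarrow>
        (\<integral>z. ?loss (erm ?loss ?H n s) z \<partial>K) \<le> (\<integral>z. ?loss h z \<partial>K) + 2 * \<eta>"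
  proof -
    have "\<exists>S \<in> sets (PiM {..<n} (\<lambda>_. K)).
        measure (PiM {..<n} (\<lambda>_. K)) S
          \<ge> 1 - 2 * real (card ?H) * exp (- 2 * real n * \<eta>\<^sup>2 / (2 * real q)\<^sup>2) \<and>
        (\<forall>s\<in>S. erm ?loss ?H n s \<in> ?H \<and>
          (\<forall>h\<in>?H. (\<integral>z. ?loss (erm ?loss ?H n s) z \<partial>K) \<le> (\<integral>z. ?loss h z \<partial>K) + 2 * \<eta>))"
    proof (rule erm_generalizes[where loss = ?loss])
      show "?loss h \<in> borel_measurable K" "?loss h z \<in> {0..2 * real q}" if "h \<in> ?H" for h z
        by (rule cell_thresholds_loss[OF q0 sets_K that])+
    qed (use prob_K finite_cell_thresholds cell_thresholds_nonempty[OF q0] q0 n'(2) \<eta> in auto)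
    then show thesis using that by blast
  qed
  have "accurate d \<epsilon> K (erm ?loss ?H n s)" if s: "s \<in> S" for s
  proof -
    let ?h = "erm ?loss ?H n s"
    have "ecr K ?h \<le> ennreal (1 + \<epsilon>) * ecr K \<theta>" if \<theta>: "\<theta> \<in> threshold_fns d" for \<theta>
    proof -
      obtain h where h: "h \<in> ?H" "ecr K h \<le> ennreal ((1 + 5 / real q)\<^sup>2) * ecr K \<theta>"
        using cell_thresholds_approx[OF K lip \<open>0 < L\<close> \<open>0 < N\<close> _ fine \<theta>] q by auto
      have "ecr K ?h \<le> ennreal ((\<integral>z. ?loss h z \<partial>K) + 2 * \<eta>)"
        unfolding ecr_eq_integral(1)[OF q0 K S(3)[OF s]] by (intro ennreal_leI S(4)[OF s h(1)])
      also have "\<dots> = ecr K h + ennreal (2 * \<eta>)"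
        using ecr_eq_integral[OF q0 K h(1)] \<eta> by (simp add: ennreal_plus)
      also have "\<dots> \<le> ennreal ((1 + 5 * \<eta>)\<^sup>2) * ecr K \<theta> + ennreal (2 * \<eta>) * ecr K \<theta>"
        using h(2) mult_left_mono[OF ecr_ge_1[OF K \<theta>], of "ennreal (2 * \<eta>)"]
        by (intro add_mono) (auto simp: \<eta>_def)
      also have "\<dots> = ennreal ((1 + 5 * \<eta>)\<^sup>2 + 2 * \<eta>) * ecr K \<theta>"
        using \<eta> by (simp add: ennreal_plus distrib_right)
      also have "\<dots> \<le> ennreal (1 + \<epsilon>) * ecr K \<theta>"
      proof (intro mult_right_mono ennreal_leI)
        have "25 * \<eta> * \<eta> \<le> 1 * \<eta>" using \<eta> by (intro mult_right_mono) auto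
        then show "(1 + 5 * \<eta>)\<^sup>2 + 2 * \<eta> \<le> 1 + \<epsilon>" using \<epsilon>\<eta> by (simp add: power2_eq_square algebra_simps)
      qed simp
      finally show ?thesis .
    qed
    then have "ecr K ?h \<le> ennreal (1 + \<epsilon>) * opt_ecr d K"
      unfolding opt_ecr_def using \<open>0 < \<epsilon>\<close> by (intro ennreal_le_mult_INF) auto
    then show ?thesis
      unfolding accurate_def using S(3)[OF s] cell_thresholds_subset[OF q0] by auto
  qed
  moreover have "1 - \<epsilon> powr real d \<le> measure (PiM {..<n} (\<lambda>_. K)) S" using S(2) fail by linarith
  ultimately show ?thesis using S(1) by blast
qed

section \<open>Sample size and choice of parameters\<close>

text \<open>Each quantity is dominated by a power of \<open>\<Lambda>\<close>. The union bound term
  gives \<open>10 * d + 4\<close>, the factor \<open>q^4\<close> adds 8, and the constant 6 costs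
  one more power; \<open>10 * d + 13 \<le> 25 * d\<close> as \<open>d \<ge> 1\<close>.\<close>

lemma sample_size_bound:
  fixes \<Lambda> :: real
  assumes \<Lambda>: "100 \<le> \<Lambda>" and q: "real q \<le> \<Lambda>^2" and N: "real (N + 1) \<le> \<Lambda>^10"
    and d: "1 \<le> d" "real d \<le> \<Lambda>^2"
  shows "real (2 * q^4 * (1 + (N + 1) ^ d * q\<^sup>2 + d * q)) \<le> \<Lambda> powr (25 * real d)"
proof -
  have mono: "\<Lambda>^a \<le> \<Lambda>^b" if "a \<le> b" for a b using \<Lambda> that by (intro power_increasing) auto
  have "real (N + 1) ^ d * real q ^ 2 \<le> (\<Lambda>^10)^d * (\<Lambda>^2)^2"
    using \<Lambda> q N by (intro mult_mono power_mono) auto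
  also have "\<dots> = \<Lambda>^(10 * d + 4)" by (simp add: power_add power_mult flip: power_mult)
  finally have 1: "real (N + 1) ^ d * real q ^ 2 \<le> \<Lambda>^(10 * d + 4)" .
  have "real d * real q \<le> \<Lambda>^2 * \<Lambda>^2" using \<Lambda> q d by (intro mult_mono) auto
  also have "\<dots> = \<Lambda>^4" by (simp flip: power_add)
  also have "\<dots> \<le> \<Lambda>^(10 * d + 4)" by (rule mono) simp
  finally have 2: "real d * real q \<le> \<Lambda>^(10 * d + 4)" .
  have 3: "1 \<le> \<Lambda>^(10 * d + 4)" using mono[of 0] by simp
  have "1 + real (N + 1) ^ d * real q ^ 2 + real d * real q \<le> 3 * \<Lambda>^(10 * d + 4)"
    using 1 2 3 by linarith
  moreover have "real q ^ 4 \<le> (\<Lambda>^2)^4" using q by (intro power_mono) auto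
  ultimately have "2 * real q ^ 4 * (1 + real (N + 1) ^ d * real q ^ 2 + real d * real q)
      \<le> 2 * (\<Lambda>^2)^4 * (3 * \<Lambda>^(10 * d + 4))"
    using \<Lambda> by (intro mult_mono) auto
  also have "\<dots> = 6 * \<Lambda>^(10 * d + 12)" by (simp add: power_add flip: power_mult)
  also have "\<dots> \<le> \<Lambda> * \<Lambda>^(10 * d + 12)" using \<Lambda> by (intro mult_right_mono) auto
  also have "\<dots> = \<Lambda>^(10 * d + 13)" by (simp add: add.commute flip: power_Suc)
  also have "\<dots> \<le> \<Lambda>^(25 * d)" using d by (intro mono) simp
  also have "\<dots> = \<Lambda> powr (25 * real d)" using \<Lambda> by (subst powr_realpow[symmetric]) auto
  finally show ?thesis by (simp only: of_nat_mult of_nat_add of_nat_power of_nat_1 of_nat_numeral)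
qed

text \<open>The constants are 25 and 1. \<open>max 1 L\<close> keeps the base at least
  \<open>1 / \<epsilon>\<close> for small \<open>L\<close> too. The algorithm \<open>A\<close> is
  fixed before \<open>K\<close>, so it may depend on \<open>d\<close>, \<open>L\<close> and
  \<open>\<epsilon>\<close> only.\<close>

theorem mainTheorem1:
  shows "\<exists>C > 0. \<exists>c > 0. \<forall>d::nat. \<forall>L::real. \<forall>\<epsilon>::real.
    d \<ge> 1 \<and> L > 0 \<and> 0 < \<epsilon> \<and> \<epsilon> \<le> 1/100 \<longrightarrow>
    (\<exists>n::nat. real n \<le> (max 1 L * sqrt (real d) / \<epsilon>) powr (C * real d) \<and>
      (\<exists>A :: (nat \<Rightarrow> (nat \<Rightarrow> real) \<times> real) \<Rightarrow> (nat \<Rightarrow> real) \<Rightarrow> real.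
        \<forall>K. joint_dist d K \<and> lipschitz_dist d L K \<longrightarrow>
          (\<exists>S \<in> sets (PiM {..<n} (\<lambda>_. K)).
             measure (PiM {..<n} (\<lambda>_. K)) S \<ge> 1 - \<epsilon> powr (c * real d) \<and>
             (\<forall>s \<in> S. accurate d \<epsilon> K (A s)))))"
proof (rule exI[of _ 25], rule conjI, simp, rule exI[of _ 1], rule conjI, simp, intro allI impI)
  fix d :: nat and L \<epsilon> :: real
  assume *: "d \<ge> 1 \<and> L > 0 \<and> 0 < \<epsilon> \<and> \<epsilon> \<le> 1/100"
  define \<Lambda> where "\<Lambda> = max 1 L * sqrt (real d) / \<epsilon>"
  define W where "W = max 1 L * sqrt (real d)"
  define q where "q = nat \<lceil>13 / \<epsilon>\<rceil>"
  \<comment> \<open>The least natural number above \<open>2 * W * q^4\<close>; the strict excess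
    gives the strict bound that the earth mover lemma needs.\<close>
  define N where "N = nat \<lfloor>2 * W * real q^4\<rfloor> + 1"
  define n where "n = 2 * q^4 * (1 + (N + 1) ^ d * q\<^sup>2 + d * q)"
  have sd: "1 \<le> sqrt (real d)" using * by simp
  have W: "1 \<le> W" "L * sqrt (real d) \<le> W" "sqrt (real d) \<le> W"
    unfolding W_def using mult_mono[of 1 "max 1 L" 1 "sqrt (real d)"] 
      mult_mono[of 1 "max 1 L" "sqrt (real d)" "sqrt (real d)"] sd
    by (auto intro!: mult_right_mono)
  have inv: "100 \<le> 1 / \<epsilon>" using * by (simp add: field_simps)
  have W\<Lambda>: "\<Lambda> = W * (1 / \<epsilon>)" by (simp add: \<Lambda>_def W_def)
  have \<Lambda>: "1 / \<epsilon> \<le> \<Lambda>" "W \<le> \<Lambda>"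
    unfolding W\<Lambda> using mult_mono[OF W(1) order_refl, of "1 / \<epsilon>"] mult_mono[OF order_refl, of 1 "1 / \<epsilon>" W] W inv *
    by auto
  have q: "13 / \<epsilon> \<le> real q" "real q \<le> 13 / \<epsilon> + 1"
    unfolding q_def using inv * by (auto simp: of_nat_nat)
  have q25: "25 \<le> q" using q inv by (simp add: field_simps)
  \<comment> \<open>Numerical constants are absorbed by further factors
    \<open>\<Lambda> \<ge> 100\<close>.\<close>
  have "real q \<le> 14 * \<Lambda>" using q \<Lambda> inv by simp
  also have "\<dots> \<le> \<Lambda>^2" using \<Lambda> inv by (simp add: power2_eq_square)
  finally have q\<Lambda>: "real q \<le> \<Lambda>^2" .
  have N: "2 * W * real q^4 < real N" "real N \<le> 2 * W * real q^4 + 1"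
  proof -
    have "0 \<le> 2 * W * real q^4" using W by simp
    then show "2 * W * real q^4 < real N" "real N \<le> 2 * W * real q^4 + 1"
      unfolding N_def by (auto simp: of_nat_nat) linarith+
  qed
  have "L * sqrt (real d) / real N < (1 / real q)^4 / 2"
  proof -
    have "2 * (L * sqrt (real d)) * real q^4 \<le> 2 * W * real q^4" using W by (intro mult_right_mono) auto
    also note N(1)
    finally show ?thesis using q25 by (simp add: field_simps N_def)
  qed
  moreover have "real n \<le> \<Lambda> powr (25 * real d)"
    unfolding n_def
  proof (rule sample_size_bound)
    show "100 \<le> \<Lambda>" using \<Lambda> inv by simp
    then have \<Lambda>9: "2 \<le> \<Lambda>^9" using power_increasing[of 1 9 \<Lambda>] by simp
    have "W * real q^4 \<le> \<Lambda> * (\<Lambda>^2)^4" using \<Lambda> W q\<Lambda> by (intro mult_mono power_mono) auto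
    then have "W * real q^4 \<le> \<Lambda>^9" by (simp flip: power_mult power_Suc)
    then have "real (N + 1) \<le> 4 * \<Lambda>^9" using N(2) \<Lambda>9 by simp
    also have "\<dots> \<le> \<Lambda> * \<Lambda>^9" using \<Lambda> inv by (intro mult_right_mono) auto
    also have "\<dots> = \<Lambda>^10" by (simp flip: power_Suc)
    finally show "real (N + 1) \<le> \<Lambda>^10" .
    have "sqrt (real d)^2 \<le> \<Lambda>^2" using W \<Lambda> by (intro power_mono) auto
    then show "real d \<le> \<Lambda>^2" by simp
  qed (use * q\<Lambda> in auto)
  moreover have "0 < N" by (simp add: N_def)
  ultimately show "\<exists>n::nat. real n \<le> (max 1 L * sqrt (real d) / \<epsilon>) powr (25 * real d) \<and>
      (\<exists>A :: (nat \<Rightarrow> (nat \<Rightarrow> real) \<times> real) \<Rightarrow> (nat \<Rightarrow> real) \<Rightarrow> real.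
        \<forall>K. joint_dist d K \<and> lipschitz_dist d L K \<longrightarrow>
          (\<exists>S \<in> sets (PiM {..<n} (\<lambda>_. K)).
             measure (PiM {..<n} (\<lambda>_. K)) S \<ge> 1 - \<epsilon> powr (1 * real d) \<and>
             (\<forall>s \<in> S. accurate d \<epsilon> K (A s))))"
    using learn_cell_thresholds[of L \<epsilon> N q d n] * q25 q(1) n_def
    by (intro exI[of _ n] conjI exI[of _ "erm (\<lambda>h z. g (h (fst z)) (snd z)) (cell_thresholds d N q) n"])
       (simp_all add: \<Lambda>_def)
qed

end
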